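(* Let $G$ be a finite graph on vertex set $[n]$ and let $\mathbf{p} = (p_1, \ldots, p_n)$ be an optimal vector coloring of $G$ of maximum possible rank, with $p_i \in \mathbb{R}^{\rk(G)}$. Let $P$ be the $n\times \rk(G)$ matrix whose $i$-th row is $p_i^T$. Then a matrix $M$ is the Gram matrix of an optimal vector coloring of $G$ if and only if $M = P(I+R)P^T$ for some symmetric $\rk(G) \times \rk(G)$ matrix $R$ satisfying (i) $p_i^T R p_i = 0$ for all $i \in [n]$; (ii) $p_i^T R p_j \le -1 - p_i^Tp_j$ for all adjacent $i \sim j$; (iii) $I+R$ is positive semidefinite.
   Context: For real $t\ge1$, a vector $t$-coloring of $G$ assigns real vectors $p_i$ to vertices with $p_i^Tp_i=t-1$ for all $i$ and $p_i^Tp_j\le-1$ for $i\sim j$. $\chi_v(G)$ is the least $t$ admitting a vector $t$-coloring; vector $\chi_v(G)$-colorings are optimal. The rank of a vector coloring is the dimension of the span of its vectors, and $\rk(G)$ is the maximum rank of an optimal vector coloring of $G$. *)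

theory Defs
  imports "Jordan_Normal_Form.DL_Rank" "Graph_Theory.Pair_Digraph"
begin

text \<open>Finite simple graphs are symmetric loop-free digraphs (locale \<open>pair_graph\<close>), adjacency being
  membership in \<open>parcs G\<close>. Dimensions are natural numbers rather than types, because the ambient
  dimension of a coloring varies and the maximum rank is \<open>0\<close> for an edgeless graph.\<close>

definition vector_coloring :: "'a pair_pre_digraph \<Rightarrow> real \<Rightarrow> nat \<Rightarrow> ('a \<Rightarrow> real vec) \<Rightarrow> bool" where
  "vector_coloring G t d p \<longleftrightarrow>
     t \<ge> 1 \<and>
     (\<forall>i\<in>pverts G. p i \<in> carrier_vec d \<and> p i \<bullet> p i = t - 1) \<and>
     (\<forall>i j. (i, j) \<in> parcs G \<longrightarrow> p i \<bullet> p j \<le> -1)"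

text \<open>The minimum is attained: the pairs of an admissible \<open>t\<close> and the Gram matrix of a coloring form a
  closed set, whose matrices have entries bounded by \<open>t - 1\<close>, and a finite simple graph has a coloring.\<close>

definition vector_chromatic_number :: "'a pair_pre_digraph \<Rightarrow> real" where
  "vector_chromatic_number G = (LEAST t. \<exists>d p. vector_coloring G t d p)"

definition optimal_vector_coloring :: "'a pair_pre_digraph \<Rightarrow> nat \<Rightarrow> ('a \<Rightarrow> real vec) \<Rightarrow> bool" where
  "optimal_vector_coloring G d p \<longleftrightarrow> vector_coloring G (vector_chromatic_number G) d p"

definition (in vec_space) span_dim :: "'a vec set \<Rightarrow> nat" where
  "span_dim S = vectorspace.dim class_ring (span_vs S)"

definition coloring_rank :: "'a pair_pre_digraph \<Rightarrow> nat \<Rightarrow> ('a \<Rightarrow> real vec) \<Rightarrow> nat" where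
  "coloring_rank G d p = vec_space.span_dim d (p ` pverts G)"

definition max_coloring_rank :: "'a pair_pre_digraph \<Rightarrow> nat" where
  "max_coloring_rank G = Max {coloring_rank G d p | d p. optimal_vector_coloring G d p}"

text \<open>The vertex set \<open>[n]\<close> is taken to be \<open>{0..<n}\<close>, as matrix indices start at \<open>0\<close>.\<close>

definition gram_matrix :: "nat \<Rightarrow> (nat \<Rightarrow> real vec) \<Rightarrow> real mat" where
  "gram_matrix n p = mat n n (\<lambda>(i, j). p i \<bullet> p j)"

definition positive_semidefinite :: "real mat \<Rightarrow> bool" where
  "positive_semidefinite A \<longleftrightarrow>
     square_mat A \<and> transpose_mat A = A \<and>
     (\<forall>v\<in>carrier_vec (dim_row A). v \<bullet> (A *\<^sub>v v) \<ge> 0)"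

end

theory Submission
  imports Defs
begin

(* If q is any optimal coloring, then so is the orthogonal direct sum (p, q) / sqrt 2. By the
   maximality of the rank r of p, its vectors span at most r dimensions, while their projections to
   the first component already span R^r. So that projection is injective on the span, which means
   that q = A p for some matrix A, and R = A^T A - I is the matrix that is asked for. Conversely,
   a factorization I + R = S^T S turns p into the coloring S p. *)

section \<open>Spans and dimensions\<close>

context vec_space
begin

text \<open>A maximal linearly independent subset of \<open>S\<close> works: an element of
  \<open>S\<close> outside its span could be added to it without losing independence.\<close>

lemma span_dim_obtains_basis:
  assumes S: "S \<subseteq> carrier_vec n" and fin: "finite S"
  obtains U where "U \<subseteq> S" "lin_indpt U" "card U = span_dim S" "S \<subseteq> span U"
proof -
  let ?P = "\<lambda>T. T \<subseteq> S \<and> lin_indpt T"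
  have "?P {}" by (meson empty_iff empty_subsetI finite.emptyI finite_lin_indpt2)
  then obtain U where U: "maximal U ?P"
    using maximal_exists_superset[OF fin, of ?P "{}"] by blast
  then have US: "U \<subseteq> S" and li: "lin_indpt U" by (simp_all add: maximal_def)
  have "s \<in> span U" if s: "s \<in> S" for s
  proof (rule ccontr)
    assume s_notin: "s \<notin> span U"
    have "s \<notin> U" using s_notin US S in_own_span[of U] by auto
    then have "lin_indpt (U \<union> {s})"
      using lin_dep_iff_in_span[of U s] US S li s s_notin by auto
    then have "U \<union> {s} = U" using U US s unfolding maximal_def by blast
    with \<open>s \<notin> U\<close> show False by blast
  qed
  moreover have "card U = span_dim S"
    unfolding span_dim_def using dim_span[OF _ fin U] S by simp
  ultimately show ?thesis using that US li by blast
qed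

lemma span_dim_le_card:
  assumes "S \<subseteq> carrier_vec n" and "finite S"
  shows "span_dim S \<le> card S"
proof -
  obtain U where "U \<subseteq> S" "lin_indpt U" "card U = span_dim S" "S \<subseteq> span U"
    by (rule span_dim_obtains_basis[OF assms])
  then show ?thesis using card_mono[OF assms(2)] by metis
qed

text \<open>A rank factorization. The columns of \<open>C\<close> are a basis of the span of
  \<open>S\<close>, and each element of \<open>S\<close> is given by its coordinates. The width is
  exactly \<open>k\<close>, so that the bound on the dimension fixes the format of
  \<open>C\<close>.\<close>

lemma span_dim_factor:
  assumes S: "S \<subseteq> carrier_vec n" and fin: "finite S" and k: "span_dim S \<le> k"
  obtains C where "C \<in> carrier_mat n k"
    "\<And>s. s \<in> S \<Longrightarrow> \<exists>c\<in>carrier_vec k. s = C *\<^sub>v c"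
proof -
  obtain U where US: "U \<subseteq> S" and "lin_indpt U" and U: "card U = span_dim S" "S \<subseteq> span U"
    by (rule span_dim_obtains_basis[OF S fin])
  obtain us where us: "set us = U" "length us = card U"
    using finite_distinct_list[of U] US fin by (metis distinct_card finite_subset)
  \<comment> \<open>The basis may have fewer than \<open>k\<close> elements; zero columns fill it up
    without changing the span.\<close>
  define vs where "vs = us @ replicate (k - length us) (0\<^sub>v n)"
  have len: "length vs = k" using us U k by (simp add: vs_def)
  have vs: "set vs \<subseteq> carrier_vec n" using us US S by (auto simp: vs_def)
  have Uvs: "U \<subseteq> set vs" using us by (auto simp: vs_def)
  show ?thesis
  proof (rule that)
    show "mat_of_cols n vs \<in> carrier_mat n k" using len by auto
    fix s assume "s \<in> S"
    then have "s \<in> span_list vs"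
      using U(2) span_is_monotone[OF Uvs] span_list_as_span[OF vs] by auto
    then obtain c where "s = lincomb_list c vs" by (rule in_span_listE)
    moreover have "\<forall>w\<in>set vs. dim_vec w = n" using vs by auto
    ultimately have "s = mat_of_cols n vs *\<^sub>v vec k c"
      by (simp add: lincomb_list_as_mat_mult len)
    then show "\<exists>c\<in>carrier_vec k. s = mat_of_cols n vs *\<^sub>v c" by auto
  qed
qed

lemma span_eq_carrier_if_span_dim_full:
  assumes S: "S \<subseteq> carrier_vec n" and fin: "finite S" and full: "span_dim S = n"
  shows "span S = carrier_vec n"
proof -
  obtain U where U: "U \<subseteq> S" "lin_indpt U" "card U = span_dim S" "S \<subseteq> span U"
    by (rule span_dim_obtains_basis[OF S fin])
  have "basis U"
  proof (rule dim_li_is_basis[OF fin_dim])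
    show "finite U" using U(1) fin by (rule finite_subset)
    show "U \<subseteq> carrier_vec n" using U(1) S by simp
    show "dim \<le> card U" using U(3) full dim_is_n by simp
  qed (rule U(2))
  then have "span U = carrier_vec n" by (simp add: basis_def)
  then show ?thesis using span_is_monotone[OF U(1)] span_is_subset2[of S] S by auto
qed

end

section \<open>Linear maps determined on a spanning family\<close>

text \<open>The orthogonality extends from \<open>S\<close> to its span, which is the whole space,
  so \<open>v\<close> is orthogonal to itself.\<close>

lemma full_span_orthogonal_zero:
  fixes v :: "real vec"
  assumes S: "S \<subseteq> carrier_vec m" and fin_S: "finite S" and full: "vec_space.span_dim m S = m"
    and v: "v \<in> carrier_vec m" and orth: "\<And>s. s \<in> S \<Longrightarrow> v \<bullet> s = 0"
  shows "v = 0\<^sub>v m"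
proof -
  interpret vec_space "TYPE(real)" m .
  have span: "span S = carrier_vec m"
    by (rule span_eq_carrier_if_span_dim_full[OF S fin_S full])
  have "v \<in> orthogonal_complement S"
    using v orth by (simp add: orthogonal_complement_def)
  then have "v \<in> orthogonal_complement (carrier_vec m)"
    using in_orthogonal_complement_span[OF S] span by simp
  then have "v \<bullet> v = 0" using v by (simp add: orthogonal_complement_def)
  then show ?thesis
    using conjugate_square_eq_0_vec[OF v] by simp
qed

text \<open>If \<open>B\<close> were singular, a nonzero vector in the kernel of its transpose would
  be orthogonal to the column space of \<open>B\<close>, hence to the spanning set
  \<open>S\<close>.\<close>

lemma spanning_factor_invertible:
  fixes B :: "real mat"
  assumes B: "B \<in> carrier_mat m m" and S: "S \<subseteq> carrier_vec m" and fin: "finite S"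
    and full: "vec_space.span_dim m S = m"
    and factor: "\<And>s. s \<in> S \<Longrightarrow> \<exists>c\<in>carrier_vec m. s = B *\<^sub>v c"
  obtains Y where "Y \<in> carrier_mat m m" "Y * B = 1\<^sub>m m"
proof -
  have "det B \<noteq> 0"
  proof
    assume "det B = 0"
    then have "det (transpose_mat B) = 0" using det_transpose[OF B] by simp
    then obtain v where v: "v \<in> carrier_vec m" "v \<noteq> 0\<^sub>v m" "transpose_mat B *\<^sub>v v = 0\<^sub>v m"
      using det_0_iff_vec_prod_zero_field[of "transpose_mat B" m] B by auto
    have "v \<bullet> s = 0" if s: "s \<in> S" for s
    proof -
      obtain c where "c \<in> carrier_vec m" "s = B *\<^sub>v c" using factor[OF s] by blast
      then show ?thesis using transpose_vec_mult_scalar[OF B _ v(1), of c] v(3) by simp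
    qed
    then show False using full_span_orthogonal_zero[OF S fin full v(1)] v(2) by blast
  qed
  from det_non_zero_imp_unit[OF B this, of "()"] show ?thesis
    using that unfolding Units_def by (auto simp: ring_mat_simps)
qed

text \<open>A rank factorization of the stacked vectors has \<open>m\<close> columns, so its upper
  block is square. Both blocks act on the same coordinates \<open>x\<close>. Since the vectors
  \<open>p i\<close> span, the upper block is invertible; hence \<open>p i\<close> determines
  \<open>x\<close>, and \<open>x\<close> determines \<open>q i\<close>.\<close>

lemma low_rank_sum_imp_linear_image:
  fixes p q :: "'a \<Rightarrow> real vec"
  assumes fin: "finite I" and p: "\<And>i. i \<in> I \<Longrightarrow> p i \<in> carrier_vec m"
    and q: "\<And>i. i \<in> I \<Longrightarrow> q i \<in> carrier_vec d" and c: "c \<noteq> 0"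
    and full: "vec_space.span_dim m (p ` I) = m"
    and low: "vec_space.span_dim (m + d) ((\<lambda>i. c \<cdot>\<^sub>v (p i @\<^sub>v q i)) ` I) \<le> m"
  obtains A where "A \<in> carrier_mat d m" "\<And>i. i \<in> I \<Longrightarrow> q i = A *\<^sub>v p i"
proof -
  let ?w = "\<lambda>i. c \<cdot>\<^sub>v (p i @\<^sub>v q i)"
  have w: "?w ` I \<subseteq> carrier_vec (m + d)" using p q by auto
  obtain C where C: "C \<in> carrier_mat (m + d) m"
    and wC: "\<And>s. s \<in> ?w ` I \<Longrightarrow> \<exists>x\<in>carrier_vec m. s = C *\<^sub>v x"
    using vec_space.span_dim_factor[OF w _ low] fin by blast
  \<comment> \<open>The upper and lower blocks of \<open>C\<close>, divided by \<open>c\<close> to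
    undo the scaling of the stacked vectors.\<close>
  define C1 where "C1 = mat m m (\<lambda>(i, k). C $$ (i, k) / c)"
  define C2 where "C2 = mat d m (\<lambda>(i, k). C $$ (m + i, k) / c)"
  have pq: "\<exists>x\<in>carrier_vec m. p i = C1 *\<^sub>v x \<and> q i = C2 *\<^sub>v x" if i: "i \<in> I" for i
  proof -
    obtain x where x: "x \<in> carrier_vec m" and wx: "?w i = C *\<^sub>v x" using wC i by blast
    have pi: "p i \<in> carrier_vec m" and qi: "q i \<in> carrier_vec d" using p q i by auto
    have Cx: "(\<Sum>l = 0..<m. C $$ (k, l) * x $ l) = c * (p i @\<^sub>v q i) $ k" if "k < m + d" for k
      using arg_cong[OF wx, of "\<lambda>v. v $ k"] that pi qi C x
      by (simp add: scalar_prod_def)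
    have "p i = C1 *\<^sub>v x"
    proof (rule eq_vecI)
      fix k assume "k < dim_vec (C1 *\<^sub>v x)"
      then have k: "k < m" by (simp add: C1_def)
      have "(C1 *\<^sub>v x) $ k = (\<Sum>l = 0..<m. C $$ (k, l) * x $ l) / c"
        using k x by (simp add: C1_def scalar_prod_def sum_divide_distrib)
      also have "\<dots> = p i $ k" using Cx[of k] k c pi qi by simp
      finally show "p i $ k = (C1 *\<^sub>v x) $ k" by simp
    qed (use pi in \<open>simp add: C1_def\<close>)
    moreover have "q i = C2 *\<^sub>v x"
    proof (rule eq_vecI)
      fix k assume "k < dim_vec (C2 *\<^sub>v x)"
      then have k: "k < d" by (simp add: C2_def)
      have "(C2 *\<^sub>v x) $ k = (\<Sum>l = 0..<m. C $$ (m + k, l) * x $ l) / c"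
        using k x by (simp add: C2_def scalar_prod_def sum_divide_distrib)
      also have "\<dots> = q i $ k" using Cx[of "m + k"] k c pi qi by simp
      finally show "q i $ k = (C2 *\<^sub>v x) $ k" by simp
    qed (use qi in \<open>simp add: C2_def\<close>)
    ultimately show ?thesis using x by blast
  qed
  have C1: "C1 \<in> carrier_mat m m" and C2: "C2 \<in> carrier_mat d m"
    by (simp_all add: C1_def C2_def)
  have "p ` I \<subseteq> carrier_vec m" using p by auto
  moreover have "\<exists>x\<in>carrier_vec m. s = C1 *\<^sub>v x" if "s \<in> p ` I" for s using pq that by blast
  ultimately obtain Y where Y: "Y \<in> carrier_mat m m" "Y * C1 = 1\<^sub>m m"
    using spanning_factor_invertible[OF C1 _ _ full] fin by blast
  show ?thesis
  proof (rule that)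
    show "C2 * Y \<in> carrier_mat d m" using C2 Y by simp
    fix i assume "i \<in> I"
    then obtain x where x: "x \<in> carrier_vec m" "p i = C1 *\<^sub>v x" "q i = C2 *\<^sub>v x"
      using pq by blast
    have "(C2 * Y) *\<^sub>v p i = C2 *\<^sub>v (Y *\<^sub>v (C1 *\<^sub>v x))"
      using assoc_mult_mat_vec[OF C2 Y(1), of "C1 *\<^sub>v x"] x C1 by simp
    also have "Y *\<^sub>v (C1 *\<^sub>v x) = x"
      using assoc_mult_mat_vec[OF Y(1) C1 x(1)] Y(2) x(1) by simp
    finally show "q i = (C2 * Y) *\<^sub>v p i" using x(3) by simp
  qed
qed

section \<open>Positive semidefinite matrices\<close>

text \<open>With a nonzero slope the function would take the value -1, at
  \<open>- (a + 1) / b\<close>.\<close>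

lemma affine_nonneg_imp_slope_zero:
  fixes a b :: real
  assumes "\<And>t. 0 \<le> a + b * t"
  shows "b = 0"
proof (rule ccontr)
  assume "b \<noteq> 0"
  then have "a + b * (- (a + 1) / b) = - 1" by (simp add: field_simps)
  then show False using assms[of "- (a + 1) / b"] by simp
qed

text \<open>A Cholesky decomposition by induction on \<open>n\<close>: completing the square in the
  last variable leaves a nonnegative form in the remaining ones. The coefficients are functions
  rather than matrices, so passing to fewer variables changes no carrier.\<close>

lemma psd_form_gram:
  fixes a :: "nat \<Rightarrow> nat \<Rightarrow> real"
  assumes "\<And>i j. i < n \<Longrightarrow> j < n \<Longrightarrow> a i j = a j i"
    and "\<And>v. 0 \<le> (\<Sum>i<n. \<Sum>j<n. a i j * v i * v j)"
  shows "\<exists>b. \<forall>i<n. \<forall>j<n. a i j = (\<Sum>k<n. b k i * b k j)"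
  using assms
proof (induction n arbitrary: a)
  case 0
  then show ?case by simp
next
  case (Suc n)
  define e where "e = a n n"
  define L where "L v = (\<Sum>i<n. a i n * v i)" for v
  define Q where "Q v = (\<Sum>i<n. \<Sum>j<n. a i j * v i * v j)" for v
  have sym: "a n i = a i n" if "i < n" for i using Suc.prems(1)[of n i] that by simp
  \<comment> \<open>The form at \<open>v\<close> extended by the last coordinate \<open>t\<close>,
    as a quadratic polynomial in \<open>t\<close>.\<close>
  have nonneg: "0 \<le> Q v + 2 * t * L v + e * t\<^sup>2" for v t
  proof -
    define u where "u = v(n := t)"
    have "(\<Sum>i<Suc n. \<Sum>j<Suc n. a i j * u i * u j)
        = (\<Sum>i<n. (\<Sum>j<n. a i j * v i * v j) + a i n * v i * t)
          + ((\<Sum>j<n. a j n * t * v j) + a n n * t * t)"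
      by (simp add: u_def sym)
    also have "\<dots> = Q v + 2 * t * L v + e * t\<^sup>2"
      by (simp add: Q_def L_def e_def sum.distrib sum_distrib_left power2_eq_square algebra_simps)
    finally show ?thesis using Suc.prems(2)[of u] by simp
  qed
  have e: "0 \<le> e" using nonneg[of "\<lambda>_. 0" 1] by (simp add: Q_def L_def)
  \<comment> \<open>Without a quadratic term, the polynomial for the unit vector at \<open>i\<close>
    is affine in \<open>t\<close>, and its slope is twice the entry.\<close>
  have null: "a i n = 0" if "e = 0" "i < n" for i
  proof -
    let ?v = "\<lambda>k. if k = i then 1 else 0"
    have "L ?v = a i n" using that by (simp add: L_def if_distrib cong: if_cong)
    then have "0 \<le> Q ?v + 2 * a i n * t" for t
      using nonneg[of ?v t] that by (simp add: algebra_simps)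
    then have "2 * a i n = 0" by (rule affine_nonneg_imp_slope_zero)
    then show ?thesis by simp
  qed
  \<comment> \<open>The Schur complement. For \<open>e = 0\<close>, division by zero makes it the leading block.\<close>
  define a' where "a' i j = a i j - a i n * a j n / e" for i j
  have "0 \<le> (\<Sum>i<n. \<Sum>j<n. a' i j * v i * v j)" for v
  proof -
    have "(\<Sum>i<n. \<Sum>j<n. a' i j * v i * v j) = Q v - L v * L v / e"
      by (simp add: a'_def Q_def L_def sum_product sum_subtractf sum_divide_distrib algebra_simps)
    \<comment> \<open>For \<open>e > 0\<close> the value \<open>- L v / e\<close> of
      \<open>t\<close> minimizes the polynomial; for \<open>e = 0\<close> it is 0, and both sides
      equal \<open>Q v\<close>.\<close>
    also have "\<dots> = Q v + 2 * (- L v / e) * L v + e * (- L v / e)\<^sup>2"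
      by (cases "e = 0") (simp_all add: power2_eq_square field_simps)
    finally show ?thesis using nonneg by metis
  qed
  moreover have "a' i j = a' j i" if "i < n" "j < n" for i j
    using Suc.prems(1)[of i j] that by (simp add: a'_def)
  ultimately obtain b where b: "\<And>i j. i < n \<Longrightarrow> j < n \<Longrightarrow> a' i j = (\<Sum>k<n. b k i * b k j)"
    using Suc.IH[of a'] by blast
  \<comment> \<open>The new row \<open>n\<close> reproduces the term that the Schur complement
    subtracts. The old rows get 0 in the new column, so they contribute nothing when an index equals
    \<open>n\<close>.\<close>
  define b' where "b' k i = (if k = n then a i n / sqrt e else if i = n then 0 else b k i)" for k i
  have last: "b' n i * b' n j = a i n * a j n / e" for i j
    using e by (simp add: b'_def)
  have "a i j = (\<Sum>k<Suc n. b' k i * b' k j)" if ij: "i < Suc n" "j < Suc n" for i j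
  proof (cases "i < n \<and> j < n")
    case True
    then have "(\<Sum>k<n. b' k i * b' k j) = a' i j" by (simp add: b b'_def)
    then show ?thesis by (simp add: last a'_def)
  next
    case False
    then have "(\<Sum>k<n. b' k i * b' k j) = 0"
      using ij by (intro sum.neutral) (auto simp: b'_def less_Suc_eq)
    \<comment> \<open>One of the two factors is \<open>e\<close> itself and cancels; for
      \<open>e = 0\<close> both sides vanish.\<close>
    moreover have "a i j = a i n * a j n / e"
      using False ij sym null by (cases "e = 0") (auto simp: less_Suc_eq e_def)
    ultimately show ?thesis by (simp add: last)
  qed
  then show ?case by blast
qed

text \<open>The factorization of \<open>psd_form_gram\<close> in matrix form. As \<open>S\<close> is
  square, applying it to a coloring keeps the dimension.\<close>

lemma positive_semidefinite_factor:
  assumes A: "A \<in> carrier_mat m m" and psd: "positive_semidefinite A"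
  obtains S where "S \<in> carrier_mat m m" "A = transpose_mat S * S"
proof -
  have sym: "A $$ (i, j) = A $$ (j, i)" if "i < m" "j < m" for i j
    using psd A that unfolding positive_semidefinite_def by (metis carrier_matD index_transpose_mat(1))
  have "0 \<le> (\<Sum>i<m. \<Sum>j<m. A $$ (i, j) * v i * v j)" for v
  proof -
    have "vec m v \<bullet> (A *\<^sub>v vec m v) = (\<Sum>i<m. \<Sum>j<m. A $$ (i, j) * v i * v j)"
      using A by (simp add: scalar_prod_def sum_distrib_left atLeast0LessThan mult_ac)
    then show ?thesis
      using psd A unfolding positive_semidefinite_def by (metis carrier_matD(1) vec_carrier)
  qed
  then obtain b where b: "\<And>i j. i < m \<Longrightarrow> j < m \<Longrightarrow> A $$ (i, j) = (\<Sum>k<m. b k i * b k j)"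
    using psd_form_gram[of m "\<lambda>i j. A $$ (i, j)"] sym by blast
  let ?S = "mat m m (\<lambda>(k, i). b k i)"
  have "A = transpose_mat ?S * ?S"
    by (rule eq_matI) (use A in \<open>auto simp: b scalar_prod_def atLeast0LessThan\<close>)
  then show ?thesis using that[of ?S] by simp
qed

section \<open>Gram matrices under linear maps\<close>

text \<open>The transpose is the adjoint. This is how a factorization of
  \<open>1\<^sub>m r + R\<close> becomes a statement about inner products of the image
  vectors.\<close>

lemma scalar_prod_transpose_mult:
  fixes A :: "real mat"
  assumes "A \<in> carrier_mat d m" "x \<in> carrier_vec m" "y \<in> carrier_vec m"
  shows "x \<bullet> ((transpose_mat A * A) *\<^sub>v y) = (A *\<^sub>v x) \<bullet> (A *\<^sub>v y)"
proof -
  have "(transpose_mat A * A) *\<^sub>v y = transpose_mat A *\<^sub>v (A *\<^sub>v y)"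
    by (rule assoc_mult_mat_vec[of _ m d _ m]) (use assms in auto)
  moreover have "(transpose_mat (transpose_mat A) *\<^sub>v x) \<bullet> (A *\<^sub>v y)
      = x \<bullet> (transpose_mat A *\<^sub>v (A *\<^sub>v y))"
    by (rule transpose_vec_mult_scalar[of _ m d]) (use assms in auto)
  ultimately show ?thesis by simp
qed

text \<open>The quadratic form is the squared length of the image of \<open>v\<close> under
  \<open>A\<close>, a sum of squares.\<close>

lemma positive_semidefinite_transpose_mult:
  fixes A :: "real mat"
  assumes A: "A \<in> carrier_mat d m"
  shows "positive_semidefinite (transpose_mat A * A)"
  unfolding positive_semidefinite_def
proof (intro conjI ballI)
  fix v :: "real vec" assume "v \<in> carrier_vec (dim_row (transpose_mat A * A))"
  then have "v \<in> carrier_vec m" using A by simp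
  then have "v \<bullet> ((transpose_mat A * A) *\<^sub>v v) = (A *\<^sub>v v) \<bullet> (A *\<^sub>v v)"
    using scalar_prod_transpose_mult[OF A] by blast
  then show "0 \<le> v \<bullet> ((transpose_mat A * A) *\<^sub>v v)"
    by (simp add: scalar_prod_def[of "A *\<^sub>v v"] sum_nonneg)
qed (use A in \<open>auto simp: transpose_mult[of _ m d _ m]\<close>)

text \<open>This passes from the matrix equation for \<open>M\<close> to its entries, the form in
  which the conditions on \<open>R\<close> are stated.\<close>

lemma congruence_mat_of_rows:
  fixes p :: "nat \<Rightarrow> real vec"
  assumes p: "\<And>i. i < n \<Longrightarrow> p i \<in> carrier_vec m" and B: "B \<in> carrier_mat m m"
  shows "mat_of_rows m (map p [0..<n]) * B * transpose_mat (mat_of_rows m (map p [0..<n]))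
    = mat n n (\<lambda>(i, j). p i \<bullet> (B *\<^sub>v p j))"
proof -
  let ?P = "mat_of_rows m (map p [0..<n])"
  have P: "?P \<in> carrier_mat n m" by auto
  have row: "row ?P i = p i" if "i < n" for i
    using p that by (simp add: mat_of_rows_row)
  have "?P * B * transpose_mat ?P = ?P * (B * transpose_mat ?P)"
    using P B by (simp add: assoc_mult_mat[of _ n m _ m _ n])
  also have "\<dots> = mat n n (\<lambda>(i, j). p i \<bullet> (B *\<^sub>v p j))"
  proof (rule eq_matI)
    fix i j assume "i < dim_row (mat n n (\<lambda>(i, j). p i \<bullet> (B *\<^sub>v p j)))"
      and "j < dim_col (mat n n (\<lambda>(i, j). p i \<bullet> (B *\<^sub>v p j)))"
    then have ij: "i < n" "j < n" by simp_all
    have "col (B * transpose_mat ?P) j = B *\<^sub>v col (transpose_mat ?P) j"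
      using B P ij by (intro col_mult2) auto
    also have "col (transpose_mat ?P) j = p j" using P ij row by simp
    finally have "(?P * (B * transpose_mat ?P)) $$ (i, j) = p i \<bullet> (B *\<^sub>v p j)"
      using P B ij row by (subst index_mult_mat(1)) auto
    then show "(?P * (B * transpose_mat ?P)) $$ (i, j) = mat n n (\<lambda>(i, j). p i \<bullet> (B *\<^sub>v p j)) $$ (i, j)"
      using ij by simp
  qed (use P B in auto)
  finally show ?thesis .
qed

section \<open>Vector colorings\<close>

text \<open>The factor \<open>1 / sqrt 2\<close> makes each inner product the average of those of
  \<open>p\<close> and \<open>q\<close>, so the norm condition and the edge inequalities survive
  with the same \<open>t\<close>.\<close>

lemma vector_coloring_sum:
  assumes arcs: "parcs G \<subseteq> pverts G \<times> pverts G"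
    and p: "vector_coloring G t d p" and q: "vector_coloring G t d' q"
  shows "vector_coloring G t (d + d') (\<lambda>i. (1 / sqrt 2) \<cdot>\<^sub>v (p i @\<^sub>v q i))"
proof -
  have carrier: "p i \<in> carrier_vec d" "q i \<in> carrier_vec d'" if "i \<in> pverts G" for i
    using that p q by (auto simp: vector_coloring_def)
  have prod: "((1 / sqrt 2) \<cdot>\<^sub>v (p i @\<^sub>v q i)) \<bullet> ((1 / sqrt 2) \<cdot>\<^sub>v (p j @\<^sub>v q j))
      = (p i \<bullet> p j + q i \<bullet> q j) / 2" if "i \<in> pverts G" "j \<in> pverts G" for i j
    using carrier that
    by (simp add: scalar_prod_append[of _ d _ d'] smult_scalar_prod_distrib[of _ "d + d'"]
        scalar_prod_smult_distrib[of _ "d + d'"])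
  show ?thesis
    unfolding vector_coloring_def
  proof (intro conjI ballI allI impI)
    fix i assume i: "i \<in> pverts G"
    then show "((1 / sqrt 2) \<cdot>\<^sub>v (p i @\<^sub>v q i)) \<bullet> ((1 / sqrt 2) \<cdot>\<^sub>v (p i @\<^sub>v q i)) = t - 1"
      using p q by (subst prod) (auto simp: vector_coloring_def)
  next
    fix i j assume ij: "(i, j) \<in> parcs G"
    then have "p i \<bullet> p j \<le> -1" "q i \<bullet> q j \<le> -1" using p q by (auto simp: vector_coloring_def)
    then show "((1 / sqrt 2) \<cdot>\<^sub>v (p i @\<^sub>v q i)) \<bullet> ((1 / sqrt 2) \<cdot>\<^sub>v (p j @\<^sub>v q j)) \<le> -1"
      using arcs ij by (subst prod) auto
  qed (use p carrier in \<open>auto simp: vector_coloring_def\<close>)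
qed

text \<open>\<open>Max\<close> bounds the elements of a finite set. The ambient dimension is
  unbounded, but every rank is at most the number of vertices, so only finitely many ranks
  occur.\<close>

lemma coloring_rank_le_max:
  assumes fin: "finite (pverts G)" and p: "optimal_vector_coloring G d p"
  shows "coloring_rank G d p \<le> max_coloring_rank G"
proof -
  have "coloring_rank G d p \<le> card (pverts G)" if "optimal_vector_coloring G d p" for d p
  proof -
    have "p ` pverts G \<subseteq> carrier_vec d"
      using that by (auto simp: optimal_vector_coloring_def vector_coloring_def)
    then have "coloring_rank G d p \<le> card (p ` pverts G)"
      unfolding coloring_rank_def by (rule vec_space.span_dim_le_card) (simp add: fin)
    also have "\<dots> \<le> card (pverts G)" by (rule card_image_le[OF fin])
    finally show ?thesis .
  qed
  then have "finite {coloring_rank G d p | d p. optimal_vector_coloring G d p}"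
    by (intro finite_subset[OF _ finite_atMost[of "card (pverts G)"]]) auto
  then show ?thesis unfolding max_coloring_rank_def using p by (intro Max_ge) auto
qed

section \<open>Gram matrices of optimal colorings as perturbations of that of
  \<open>p\<close>\<close>

theorem mainTheorem6:
  fixes G :: "nat pair_pre_digraph" and n r :: nat
    and p :: "nat \<Rightarrow> real vec" and P M :: "real mat"
  assumes graph: "pair_graph G" and verts: "pverts G = {0..<n}"
    and r: "r = max_coloring_rank G"
    and optimal: "optimal_vector_coloring G r p"
    and max_rank: "coloring_rank G r p = r"
    and P: "P = mat_of_rows r (map p [0..<n])"
  shows "(\<exists>d q. optimal_vector_coloring G d q \<and> M = gram_matrix n q) \<longleftrightarrow>
    (\<exists>R \<in> carrier_mat r r. transpose_mat R = R \<and>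
       M = P * (1\<^sub>m r + R) * transpose_mat P \<and>
       (\<forall>i \<in> {0..<n}. p i \<bullet> (R *\<^sub>v p i) = 0) \<and>
       (\<forall>i j. (i, j) \<in> parcs G \<longrightarrow> p i \<bullet> (R *\<^sub>v p j) \<le> -1 - p i \<bullet> p j) \<and>
       positive_semidefinite (1\<^sub>m r + R))"
proof -
  interpret pair_graph G by (rule graph)
  have arcs: "i < n" "j < n" if "(i, j) \<in> parcs G" for i j
    using in_arcsD1[OF that] in_arcsD2[OF that] verts by auto
  have arcs_subset: "parcs G \<subseteq> pverts G \<times> pverts G"
    using in_arcsD1 in_arcsD2 by auto
  define t where "t = vector_chromatic_number G"
  have pt: "vector_coloring G t r p" using optimal by (simp add: optimal_vector_coloring_def t_def)
  have p: "p i \<in> carrier_vec r" "p i \<bullet> p i = t - 1" if "i < n" for i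
    using pt that verts by (auto simp: vector_coloring_def)
  \<comment> \<open>The entry of \<open>p\<close> is split from the correction by \<open>R\<close>,
    on which conditions (i) and (ii) are imposed.\<close>
  have shift: "p i \<bullet> ((1\<^sub>m r + R) *\<^sub>v p j) = p i \<bullet> p j + p i \<bullet> (R *\<^sub>v p j)"
    if "R \<in> carrier_mat r r" "i < n" "j < n" for R i j
    using that p by (simp add: add_mult_distrib_mat_vec[of _ r r] scalar_prod_add_distrib[of _ r])
  show ?thesis
  proof
    assume "\<exists>d q. optimal_vector_coloring G d q \<and> M = gram_matrix n q"
    then obtain d q where qo: "optimal_vector_coloring G d q" and M: "M = gram_matrix n q" by blast
    have qt: "vector_coloring G t d q" using qo by (simp add: optimal_vector_coloring_def t_def)
    have q: "q i \<in> carrier_vec d" "q i \<bullet> q i = t - 1" if "i < n" for i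
      using qt that verts by (auto simp: vector_coloring_def)
    have "optimal_vector_coloring G (r + d) (\<lambda>i. (1 / sqrt 2) \<cdot>\<^sub>v (p i @\<^sub>v q i))"
      using vector_coloring_sum[OF arcs_subset pt qt]
      by (simp add: optimal_vector_coloring_def t_def)
    \<comment> \<open>The combined coloring is optimal as well, so the maximality of
      \<open>r\<close> bounds its rank.\<close>
    then have low: "vec_space.span_dim (r + d) ((\<lambda>i. (1 / sqrt 2) \<cdot>\<^sub>v (p i @\<^sub>v q i)) ` {0..<n}) \<le> r"
      using coloring_rank_le_max[of G] verts r by (simp add: coloring_rank_def)
    have full: "vec_space.span_dim r (p ` {0..<n}) = r"
      using max_rank verts by (simp add: coloring_rank_def)
    obtain A where A: "A \<in> carrier_mat d r" and qA: "\<And>i. i \<in> {0..<n} \<Longrightarrow> q i = A *\<^sub>v p i"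
      using low_rank_sum_imp_linear_image[of "{0..<n}" p r q d "1 / sqrt 2", OF _ _ _ _ full low] p q
      by auto
    \<comment> \<open>Chosen so that \<open>1\<^sub>m r + R\<close> is
      \<open>transpose_mat A * A\<close>, whose form on the vectors of \<open>p\<close> gives the
      Gram entries of \<open>q\<close>.\<close>
    define R where "R = transpose_mat A * A - 1\<^sub>m r"
    have R: "R \<in> carrier_mat r r"
      unfolding R_def by (rule minus_carrier_mat) simp
    have IR: "1\<^sub>m r + R = transpose_mat A * A"
      by (rule eq_matI) (use A in \<open>auto simp: R_def\<close>)
    have qq: "p i \<bullet> ((1\<^sub>m r + R) *\<^sub>v p j) = q i \<bullet> q j" if "i < n" "j < n" for i j
      using scalar_prod_transpose_mult[OF A p(1) p(1)] that qA by (simp add: IR)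
    \<comment> \<open>On the diagonal both products are \<open>t - 1\<close>, which yields (i); on
      an edge the product for \<open>q\<close> is at most -1, which yields (ii).\<close>
    have pRp: "p i \<bullet> (R *\<^sub>v p j) = q i \<bullet> q j - p i \<bullet> p j" if "i < n" "j < n" for i j
      using qq[OF that] shift[OF R that] by simp
    show "\<exists>R \<in> carrier_mat r r. transpose_mat R = R \<and>
       M = P * (1\<^sub>m r + R) * transpose_mat P \<and>
       (\<forall>i \<in> {0..<n}. p i \<bullet> (R *\<^sub>v p i) = 0) \<and>
       (\<forall>i j. (i, j) \<in> parcs G \<longrightarrow> p i \<bullet> (R *\<^sub>v p j) \<le> -1 - p i \<bullet> p j) \<and>
       positive_semidefinite (1\<^sub>m r + R)"
    proof (intro bexI[OF _ R] conjI ballI allI impI)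
      show "transpose_mat R = R"
        using A by (simp add: R_def transpose_minus[of _ r r] transpose_mult[of _ r d _ r])
      have "P * (1\<^sub>m r + R) * transpose_mat P = mat n n (\<lambda>(i, j). p i \<bullet> ((1\<^sub>m r + R) *\<^sub>v p j))"
        unfolding P using p R by (intro congruence_mat_of_rows) auto
      then show "M = P * (1\<^sub>m r + R) * transpose_mat P"
        by (auto simp: M gram_matrix_def qq intro!: cong_mat)
      show "p i \<bullet> (R *\<^sub>v p i) = 0" if "i \<in> {0..<n}" for i
        using that pRp p(2) q(2) by simp
      show "p i \<bullet> (R *\<^sub>v p j) \<le> -1 - p i \<bullet> p j" if "(i, j) \<in> parcs G" for i j
        using that pRp arcs qt by (auto simp: vector_coloring_def)
      show "positive_semidefinite (1\<^sub>m r + R)"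
        unfolding IR by (rule positive_semidefinite_transpose_mult[OF A])
    qed
  next
    assume "\<exists>R \<in> carrier_mat r r. transpose_mat R = R \<and>
       M = P * (1\<^sub>m r + R) * transpose_mat P \<and>
       (\<forall>i \<in> {0..<n}. p i \<bullet> (R *\<^sub>v p i) = 0) \<and>
       (\<forall>i j. (i, j) \<in> parcs G \<longrightarrow> p i \<bullet> (R *\<^sub>v p j) \<le> -1 - p i \<bullet> p j) \<and>
       positive_semidefinite (1\<^sub>m r + R)"
    then obtain R where R: "R \<in> carrier_mat r r" and M: "M = P * (1\<^sub>m r + R) * transpose_mat P"
      and diag: "\<And>i. i < n \<Longrightarrow> p i \<bullet> (R *\<^sub>v p i) = 0"
      and edge: "\<And>i j. (i, j) \<in> parcs G \<Longrightarrow> p i \<bullet> (R *\<^sub>v p j) \<le> -1 - p i \<bullet> p j"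
      and psd: "positive_semidefinite (1\<^sub>m r + R)"
      by auto
    obtain S where S: "S \<in> carrier_mat r r" and IR: "1\<^sub>m r + R = transpose_mat S * S"
      by (rule positive_semidefinite_factor[OF _ psd, of r]) (use R in simp)
    \<comment> \<open>Since \<open>transpose_mat S * S\<close> is \<open>1\<^sub>m r + R\<close>,
      the images under \<open>S\<close> have the entries of \<open>M\<close> as inner
      products.\<close>
    define q where "q i = S *\<^sub>v p i" for i
    have qq: "p i \<bullet> ((1\<^sub>m r + R) *\<^sub>v p j) = q i \<bullet> q j" if "i < n" "j < n" for i j
      using scalar_prod_transpose_mult[OF S p(1) p(1)] that by (simp add: IR q_def)
    have qpR: "q i \<bullet> q j = p i \<bullet> p j + p i \<bullet> (R *\<^sub>v p j)" if "i < n" "j < n" for i j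
      using qq[OF that] shift[OF R that] by simp
    have "P * (1\<^sub>m r + R) * transpose_mat P = mat n n (\<lambda>(i, j). p i \<bullet> ((1\<^sub>m r + R) *\<^sub>v p j))"
      unfolding P using p R by (intro congruence_mat_of_rows) auto
    then have "M = gram_matrix n q"
      by (auto simp: M gram_matrix_def qq intro!: cong_mat)
    moreover have "vector_coloring G t r q"
      unfolding vector_coloring_def
    proof (intro conjI ballI allI impI)
      show "1 \<le> t" using pt by (simp add: vector_coloring_def)
      show "q i \<in> carrier_vec r" if "i \<in> pverts G" for i
        using that verts S p(1) by (simp add: q_def)
      \<comment> \<open>By (i) the correction vanishes on the diagonal, so the norms of
        \<open>p\<close> are kept; on edges (ii) is exactly the bound -1 for
        \<open>q\<close>.\<close>
      show "q i \<bullet> q i = t - 1" if "i \<in> pverts G" for i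
        using that verts qpR[of i i] p(2)[of i] diag[of i] by simp
      show "q i \<bullet> q j \<le> -1" if "(i, j) \<in> parcs G" for i j
        using that qpR[of i j] edge[of i j] arcs[OF that] by simp
    qed
    then have "optimal_vector_coloring G r q" by (simp add: optimal_vector_coloring_def t_def)
    ultimately show "\<exists>d q. optimal_vector_coloring G d q \<and> M = gram_matrix n q" by blast
  qed
qed

end
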